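(* Assume the Schanuel Subset Conjecture (SSC) holds. Then for any non-constant polynomials $P(x),Q(x)\in\overline{\mathbb{Q}}[x]$, the numbers $P(e)^{Q(e)}$ and $P(\pi)^{Q(\pi)}$ are transcendental, where $w^{u}:=e^{u\,\mathrm{Log}\,w}$ with $\mathrm{Log}$ the principal branch of the complex logarithm.
   Context: $\overline{\mathbb{Q}}$ denotes the field of algebraic numbers. A set $X\subset\mathbb{C}$ is called $\overline{\mathbb{Q}}$-dependent on a set $Y\subset\mathbb{C}$ if $\overline{\mathbb{Q}}(X)\subset\overline{\mathbb{Q}}(Y)$. The Schanuel Subset Conjecture (SSC) is the statement: for every $n\ge1$ and all $\alpha_1,\dots,\alpha_n\in\mathbb{C}$ linearly independent over $\mathbb{Q}$, if the set $\{\alpha_1,\dots,\alpha_n,e^{\alpha_1},\dots,e^{\alpha_n}\}$ is $\overline{\mathbb{Q}}$-dependent on a subset $\{\beta_1,\dots,\beta_n\}$ of itself (with $n$ elements), then $\beta_1,\dots,\beta_n$ are algebraically independent over $\mathbb{Q}$. *)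

theory Defs
  imports
    "HOL-Analysis.Analysis"
    "HOL-Computational_Algebra.Polynomial"
    "HOL-Library.Poly_Mapping"
    "HOL-Algebra.Generated_Fields"
    "HOL-Algebra.Algebraic_Closure_Type"
begin

definition Qbar_adjoin :: "complex set \<Rightarrow> complex set" where
  "Qbar_adjoin A = generate_field ring_of_type_algebra ({z. algebraic z} \<union> A)"

definition Qbar_dependent_on :: "complex set \<Rightarrow> complex set \<Rightarrow> bool" where
  "Qbar_dependent_on A B \<longleftrightarrow> Qbar_adjoin A \<subseteq> Qbar_adjoin B"

(* Families of length n are functions on nat restricted to {..<n}.
   module.independent is a property of sets, so injectivity excludes repeated entries. *)
definition Q_linearly_independent :: "nat \<Rightarrow> (nat \<Rightarrow> complex) \<Rightarrow> bool" where
  "Q_linearly_independent n \<alpha> \<longleftrightarrow>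
     inj_on \<alpha> {..<n} \<and> module.independent (\<lambda>(q::rat) z. of_rat q * z) (\<alpha> ` {..<n})"

(* A multivariate polynomial over the rationals is a finitely supported map from monomials
   to coefficients; a monomial is a finitely supported map from variable indices to exponents. *)
definition mpoly_eval :: "(nat \<Rightarrow> complex) \<Rightarrow> ((nat \<Rightarrow>\<^sub>0 nat) \<Rightarrow>\<^sub>0 rat) \<Rightarrow> complex" where
  "mpoly_eval \<beta> p =
     (\<Sum>m\<in>Poly_Mapping.keys p. of_rat (Poly_Mapping.lookup p m) * (\<Prod>i\<in>Poly_Mapping.keys m. \<beta> i ^ Poly_Mapping.lookup m i))"

definition Q_algebraically_independent :: "nat \<Rightarrow> (nat \<Rightarrow> complex) \<Rightarrow> bool" where
  "Q_algebraically_independent n \<beta> \<longleftrightarrow>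
     (\<forall>p. (\<forall>m\<in>Poly_Mapping.keys p. Poly_Mapping.keys m \<subseteq> {..<n}) \<longrightarrow> mpoly_eval \<beta> p = 0 \<longrightarrow> p = 0)"

definition Schanuel_Subset_Conjecture :: bool where
  "Schanuel_Subset_Conjecture \<longleftrightarrow>
     (\<forall>n \<alpha> \<beta>. n \<ge> 1 \<longrightarrow> Q_linearly_independent n \<alpha> \<longrightarrow>
        inj_on \<beta> {..<n} \<longrightarrow>
        \<beta> ` {..<n} \<subseteq> \<alpha> ` {..<n} \<union> (\<lambda>i. exp (\<alpha> i)) ` {..<n} \<longrightarrow>
        Qbar_dependent_on (\<alpha> ` {..<n} \<union> (\<lambda>i. exp (\<alpha> i)) ` {..<n}) (\<beta> ` {..<n}) \<longrightarrow>
        Q_algebraically_independent n \<beta>)"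

end

theory Submission
  imports Defs
begin

text \<open>
  If \<open>n\<close> independent numbers together with their exponentials form a set \<open>S\<close> that contains an
  algebraic number and is generated over the algebraic numbers by fewer than \<open>n\<close> of its elements,
  then SSC fails: the generators and the algebraic number extend to an \<open>n\<close>-element generating
  subset, which is algebraically dependent. Take \<open>c = 1\<close> for \<open>t = e\<close> and \<open>c = \<i>\<pi>\<close> for \<open>t = \<pi>\<close>, so
  that one of \<open>c, exp c\<close> is algebraic and the other one, \<open>u\<close>, generates the same field as \<open>t\<close>. Let
  \<open>L = Ln P(t)\<close> and suppose that \<open>exp (Q(t) L)\<close> is algebraic. If \<open>c, L, Q(t) L\<close> are independent, they
  and their exponentials are generated by \<open>u, L\<close>. Otherwise \<open>L\<close> lies in the field generated by \<open>u\<close>;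
  then either \<open>c, L\<close> are independent and everything is generated by \<open>u\<close>, or \<open>L\<close> is a rational
  multiple of \<open>c\<close>, and the same holds for \<open>c, Q(t) L\<close>.
\<close>

section \<open>Algebraic numbers\<close>

text \<open>Adjoining the algebraic coefficients of \<open>q\<close> to \<open>K\<close> gives a
  field \<open>F\<close> of finite dimension over \<open>K\<close>. As \<open>x\<close> is algebraic
  over \<open>F\<close>, the tower law makes \<open>simple_extension F x\<close> finite-dimensional
  over \<open>K\<close>, so its element \<open>x\<close> is algebraic over \<open>K\<close>.\<close>

lemma (in field) root_of_algebraic_poly_algebraic:
  assumes K: "subfield K R"
    and q: "q \<in> carrier ({x \<in> carrier R. (algebraic over K) x}[X])" "q \<noteq> []"
    and x: "x \<in> carrier R" "eval q x = \<zero>"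
  shows "(algebraic over K) x"
proof -
  define F where "F = finite_extension K q"
  have alg: "set q \<subseteq> {x \<in> carrier R. (algebraic over K) x}" and ld: "lead_coeff q \<noteq> \<zero>"
    using q by (auto simp: univ_poly_def polynomial_def)
  then have q_carrier: "set q \<subseteq> carrier R"
    by auto
  have F: "subfield F R"
    unfolding F_def using alg by (intro finite_extension_is_subfield[OF K q_carrier]) auto
  have "q \<in> carrier (F[X])"
    using finite_extension_mem[OF subfieldE(1)[OF K] q_carrier] ld
    by (auto simp: univ_poly_def polynomial_def F_def)
  then have x_over_F: "(algebraic over F) x"
    using algebraicI q(2) x(2) by blast
  have "finite_dimension K F"
    unfolding F_def using alg by (intro finite_extension_finite_dimension(1)[OF K q_carrier]) auto
  moreover have "finite_dimension F (simple_extension F x)"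
    using finite_dimension_simple_extension[OF F x(1)] x_over_F by blast
  ultimately have "finite_dimension K (simple_extension F x)"
    by (rule telescopic_base_dim(1)[OF K F])
  then show ?thesis
    using finite_dimension_imp_algebraic[OF K]
      simple_extension_is_subring[OF subfieldE(1)[OF F] x(1)]
      simple_extension_mem[OF subfieldE(1)[OF F] x(1)] by blast
qed

section \<open>Field types viewed as ring records\<close>

context
  fixes R :: "'a::field_char_0 ring"
  defines "R \<equiv> ring_of_type_algebra"
begin

interpretation R: field R
  unfolding R_def by (rule field_from_type_algebra)

lemma ring_of_type_algebra_sel [simp]:
  "carrier R = UNIV" "\<zero>\<^bsub>R\<^esub> = 0" "\<one>\<^bsub>R\<^esub> = 1" "x \<oplus>\<^bsub>R\<^esub> y = x + y" "x \<otimes>\<^bsub>R\<^esub> y = x * y"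
  by (simp_all add: R_def ring_of_type_algebra_def)

lemma ring_of_type_algebra_a_inv [simp]: "\<ominus>\<^bsub>R\<^esub> x = - x"
  using R.minus_equality[of "- x" x] by simp

lemma ring_of_type_algebra_m_inv [simp]: "x \<noteq> 0 \<Longrightarrow> inv\<^bsub>R\<^esub> x = inverse x"
  using R.comm_inv_char[of x "inverse x"] by simp

lemma ring_of_type_algebra_pow [simp]: "x [^]\<^bsub>R\<^esub> (n::nat) = x ^ n"
  by (induction n) simp_all

text \<open>Coefficient lists for \<open>R.eval\<close> start with the leading coefficient, those
  for \<open>Poly\<close> with the constant one; hence \<open>rev\<close>.\<close>

lemma eval_ring_of_type_algebra: "R.eval p x = poly (Poly (rev p)) x"
  by (induction p) (simp_all add: Poly_snoc poly_monom)

lemma univ_poly_ring_of_type_algebra: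
  assumes "p \<noteq> 0" "range (poly.coeff p) \<subseteq> K"
  shows "rev (coeffs p) \<in> carrier (K[X]\<^bsub>R\<^esub>)"
proof -
  have "set (coeffs p) \<subseteq> K"
    using assms by (auto simp: coeffs_def)
  then show ?thesis
    using assms(1) by (simp add: univ_poly_def polynomial_def hd_rev last_coeffs_eq_coeff_degree)
qed

lemma algebraic_over_ring_of_type_algebraI:
  assumes "p \<noteq> 0" "range (poly.coeff p) \<subseteq> K" "poly p x = 0"
  shows "(R.algebraic over K) x"
  by (rule R.algebraicI[OF univ_poly_ring_of_type_algebra[OF assms(1,2)]])
    (use assms in \<open>simp_all add: eval_ring_of_type_algebra\<close>)

lemma subfield_Rats: "subfield \<rat> R"
proof (rule R.subfieldI'[OF R.subringI])
  show "\<rat> \<subseteq> carrier R" "\<one>\<^bsub>R\<^esub> \<in> \<rat>"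
    by auto
qed auto

text \<open>The bridge over which closure results for algebraic elements of an abstract field carry
  over to the type class.\<close>

lemma algebraic_iff_algebraic_over_Rats: "algebraic x \<longleftrightarrow> (R.algebraic over \<rat>) x"
proof
  assume "algebraic x"
  then show "(R.algebraic over \<rat>) x"
    unfolding algebraic_altdef by (auto intro!: algebraic_over_ring_of_type_algebraI)
next
  assume "(R.algebraic over \<rat>) x"
  then obtain p where p: "p \<in> carrier (\<rat>[X]\<^bsub>R\<^esub>)" "p \<noteq> []" "R.eval p x = 0"
    using R.algebraicE[OF subfieldE(1)[OF subfield_Rats]] by auto
  then have Rats: "set p \<subseteq> \<rat>" and ld: "hd p \<noteq> 0"
    by (auto simp: univ_poly_def polynomial_def)
  have "\<forall>i. poly.coeff (Poly (rev p)) i \<in> \<rat>"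
    using Rats by (auto simp: nth_default_def subset_iff rev_nth)
  moreover have "Poly (rev p) \<noteq> 0"
  \<comment> \<open>\<open>Poly\<close> discards trailing zeros, so a nonempty list could still give
    0; the nonzero head of \<open>p\<close> prevents this.\<close>
  proof
    assume "Poly (rev p) = 0"
    then obtain n where "rev p = replicate n 0"
      by (auto simp: Poly_eq_0)
    then have "set p \<subseteq> {0}"
      by (metis set_replicate_conv_if set_rev empty_subsetI order_refl)
    with ld p(2) show False
      by (metis hd_in_set singletonD subsetD)
  qed
  ultimately show "algebraic x"
    using p(3) unfolding algebraic_altdef eval_ring_of_type_algebra by blast
qed

lemma subfield_algebraic: "subfield {x. algebraic x} R"
  using R.subfield_of_algebraics[OF subfield_Rats] by (simp add: algebraic_iff_algebraic_over_Rats)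

lemma algebraic_add: "algebraic (x :: 'a) \<Longrightarrow> algebraic y \<Longrightarrow> algebraic (x + y)"
  using subringE(7)[OF subfieldE(1)[OF subfield_algebraic]] by auto

lemma algebraic_mult: "algebraic (x :: 'a) \<Longrightarrow> algebraic y \<Longrightarrow> algebraic (x * y)"
  using subringE(6)[OF subfieldE(1)[OF subfield_algebraic]] by auto

lemma algebraic_root_of_algebraic_poly:
  fixes x :: 'a
  assumes "\<And>i. algebraic (poly.coeff p i)" "p \<noteq> 0" "poly p x = 0"
  shows "algebraic x"
proof -
  have "range (poly.coeff p) \<subseteq> {x \<in> carrier R. (R.algebraic over \<rat>) x}"
    using assms(1) by (auto simp: algebraic_iff_algebraic_over_Rats)
  from univ_poly_ring_of_type_algebra[OF assms(2) this] show ?thesis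
    unfolding algebraic_iff_algebraic_over_Rats
    by (rule R.root_of_algebraic_poly_algebraic[OF subfield_Rats])
      (use assms in \<open>simp_all add: eval_ring_of_type_algebra\<close>)
qed

end

lemma algebraic_of_rat [simp, intro]: "algebraic (of_rat r)"
  by (simp add: rat_imp_algebraic)

text \<open>If \<open>poly p x\<close> were algebraic, \<open>x\<close> would be a root of
  \<open>p - [:poly p x:]\<close>, which has algebraic coefficients and is nonzero because
  \<open>p\<close> is not constant.\<close>

lemma transcendental_poly:
  fixes x :: "'a::field_char_0"
  assumes "\<not> algebraic x" "\<And>i. algebraic (poly.coeff p i)" "Polynomial.degree p > 0"
  shows "\<not> algebraic (poly p x)"
proof
  assume alg: "algebraic (poly p x)"
  have "algebraic (poly.coeff (p - [:poly p x:]) i)" for i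
    using algebraic_add[of "poly.coeff p 0" "- poly p x"] assms(2) alg
    by (cases i) auto
  moreover have "p - [:poly p x:] \<noteq> 0"
    using assms(3) by (metis degree_pCons_0 eq_iff_diff_eq_0 less_irrefl)
  ultimately have "algebraic x"
    by (rule algebraic_root_of_algebraic_poly) simp
  with assms(1) show False
    by simp
qed

section \<open>Fields generated over the algebraic numbers\<close>

lemma Qbar_adjoin_incl: "x \<in> V \<Longrightarrow> x \<in> Qbar_adjoin V"
  unfolding Qbar_adjoin_def by (rule generate_field.incl) simp

lemma Qbar_adjoin_algebraic: "algebraic x \<Longrightarrow> x \<in> Qbar_adjoin V"
  unfolding Qbar_adjoin_def by (rule generate_field.incl) simp

lemma Qbar_adjoin_add: "x \<in> Qbar_adjoin V \<Longrightarrow> y \<in> Qbar_adjoin V \<Longrightarrow> x + y \<in> Qbar_adjoin V"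
  unfolding Qbar_adjoin_def
  using generate_field.eng_add[of x ring_of_type_algebra _ y] by simp

lemma Qbar_adjoin_mult: "x \<in> Qbar_adjoin V \<Longrightarrow> y \<in> Qbar_adjoin V \<Longrightarrow> x * y \<in> Qbar_adjoin V"
  unfolding Qbar_adjoin_def
  using generate_field.eng_mult[of x ring_of_type_algebra _ y] by simp

lemma Qbar_adjoin_inverse:
  assumes "x \<in> Qbar_adjoin V"
  shows "inverse x \<in> Qbar_adjoin V"
proof (cases "x = 0")
  case True
  then show ?thesis
    using assms by simp
next
  case False
  then show ?thesis
    using generate_field.m_inv[of x ring_of_type_algebra] assms
    unfolding Qbar_adjoin_def by simp
qed

lemma Qbar_adjoin_poly:
  assumes "x \<in> Qbar_adjoin V" "\<And>i. algebraic (poly.coeff p i)"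
  shows "poly p x \<in> Qbar_adjoin V"
  using assms(2)
proof (induction p)
  case 0
  then show ?case
    by (simp add: Qbar_adjoin_algebraic)
next
  case (pCons a p)
  have "algebraic a" "algebraic (poly.coeff p i)" for i
    using pCons.prems[of 0] pCons.prems[of "Suc i"] by simp_all
  then show ?case
    using pCons.IH assms(1) by (simp add: Qbar_adjoin_algebraic Qbar_adjoin_add Qbar_adjoin_mult)
qed

lemma Qbar_adjoin_minimal:
  assumes "V \<subseteq> Qbar_adjoin Y"
  shows "Qbar_adjoin V \<subseteq> Qbar_adjoin Y"
proof
  fix x assume "x \<in> Qbar_adjoin V"
  then show "x \<in> Qbar_adjoin Y"
    unfolding Qbar_adjoin_def[of V]
  proof (induction rule: generate_field.induct)
    case one
    then show ?case
      unfolding Qbar_adjoin_def by (rule generate_field.one)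
  next
    case (incl h)
    then show ?case
      using assms by (auto intro: Qbar_adjoin_algebraic)
  next
    case (a_inv h)
    then show ?case
      unfolding Qbar_adjoin_def by (intro generate_field.a_inv)
  next
    case (m_inv h)
    then show ?case
      unfolding Qbar_adjoin_def by (intro generate_field.m_inv)
  next
    case (eng_add h1 h2)
    then show ?case
      unfolding Qbar_adjoin_def by (intro generate_field.eng_add)
  next
    case (eng_mult h1 h2)
    then show ?case
      unfolding Qbar_adjoin_def by (intro generate_field.eng_mult)
  qed
qed

section \<open>Consequences of the Schanuel Subset Conjecture\<close>

lemma Q_linearly_independentI:
  assumes indep: "\<And>q i. (\<Sum>i<n. of_rat (q i) * \<alpha> i) = 0 \<Longrightarrow> i < n \<Longrightarrow> q i = 0"
  shows "Q_linearly_independent n \<alpha>"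
proof -
  interpret Q: vector_space "\<lambda>(q::rat) (z::complex). of_rat q * z"
    by unfold_locales (simp_all add: of_rat_add of_rat_mult algebra_simps)
  have inj: "inj_on \<alpha> {..<n}"
  proof (intro inj_onI, rule ccontr)
    fix i j assume ij: "i \<in> {..<n}" "j \<in> {..<n}" "\<alpha> i = \<alpha> j" "i \<noteq> j"
    \<comment> \<open>A repeated value yields the nontrivial relation
      \<open>\<alpha> i - \<alpha> j = 0\<close>.\<close>
    define q :: "nat \<Rightarrow> rat" where "q k = (if k = i then 1 else if k = j then - 1 else 0)" for k
    have "(\<Sum>k<n. of_rat (q k) * \<alpha> k) = (\<Sum>k\<in>{i, j}. of_rat (q k) * \<alpha> k)"
      using ij by (intro sum.mono_neutral_right) (auto simp: q_def)
    also have "\<dots> = 0"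
      using ij by (simp add: q_def)
    finally show False
      using indep[of q i] ij by (simp add: q_def)
  qed
  moreover have "Q.independent (\<alpha> ` {..<n})"
  proof (rule Q.independent_if_scalars_zero)
    fix f x assume "(\<Sum>x\<in>\<alpha> ` {..<n}. of_rat (f x) * x) = 0" "x \<in> \<alpha> ` {..<n}"
    then show "f x = 0"
      using indep[of "f \<circ> \<alpha>"] inj by (auto simp: sum.reindex)
  qed simp
  ultimately show ?thesis
    unfolding Q_linearly_independent_def by blast
qed

text \<open>An integer polynomial vanishing at \<open>\<beta> i\<close>, read as a polynomial in the
  variable of index \<open>i\<close> alone, is a nontrivial algebraic relation.\<close>

lemma algebraic_not_Q_algebraically_independent:
  assumes i: "i < n" and alg: "algebraic (\<beta> i)"
  shows "\<not> Q_algebraically_independent n \<beta>"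
proof
  assume indep: "Q_algebraically_independent n \<beta>"
  obtain p where p: "p \<noteq> 0" "poly (map_poly of_int p) (\<beta> i) = 0"
    using algebraicE'[OF alg] .
  let ?d = "Polynomial.degree p"
  \<comment> \<open>\<open>mono k\<close> is the \<open>k\<close>-th power of the variable of index
    \<open>i\<close>, so \<open>P\<close> is \<open>p\<close> written in that variable.\<close>
  define mono :: "nat \<Rightarrow> nat \<Rightarrow>\<^sub>0 nat" where "mono = Poly_Mapping.single i"
  define P :: "(nat \<Rightarrow>\<^sub>0 nat) \<Rightarrow>\<^sub>0 rat"
    where "P = (\<Sum>k\<le>?d. Poly_Mapping.single (mono k) (of_int (poly.coeff p k)))"
  have inj: "inj mono"
    unfolding mono_def by (rule injI) (metis lookup_single_eq)
  have lookup_P: "Poly_Mapping.lookup P m = (\<Sum>k\<le>?d. of_int (poly.coeff p k) when mono k = m)" for m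
    unfolding P_def by (simp add: lookup_sum lookup_single)
  have lookup_mono: "Poly_Mapping.lookup P (mono k) = of_int (poly.coeff p k)" if "k \<le> ?d" for k
    using that by (simp add: lookup_P inj_eq[OF inj] when_def)
  have keys_P: "Poly_Mapping.keys P \<subseteq> mono ` {..?d}"
  proof
    fix m assume "m \<in> Poly_Mapping.keys P"
    then have "(\<Sum>k\<le>?d. of_int (poly.coeff p k) when mono k = m) \<noteq> (0 :: rat)"
      by (simp add: lookup_P in_keys_iff)
    then obtain k where "k \<le> ?d" "mono k = m"
      by (metis (mono_tags, lifting) atMost_iff sum.neutral when_neq_zero)
    then show "m \<in> mono ` {..?d}"
      by auto
  qed
  \<comment> \<open>For \<open>k = 0\<close> the monomial has no keys, and the empty product equals
    \<open>\<beta> i ^ 0\<close>.\<close>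
  have eval_mono: "(\<Prod>j\<in>Poly_Mapping.keys (mono k). \<beta> j ^ Poly_Mapping.lookup (mono k) j) = \<beta> i ^ k" for k
    by (cases "k = 0") (simp_all add: mono_def)
  have "mpoly_eval \<beta> P = (\<Sum>m\<in>mono ` {..?d}. of_rat (Poly_Mapping.lookup P m)
      * (\<Prod>j\<in>Poly_Mapping.keys m. \<beta> j ^ Poly_Mapping.lookup m j))"
    unfolding mpoly_eval_def using keys_P
    by (intro sum.mono_neutral_left) (auto simp: in_keys_iff)
  also have "\<dots> = (\<Sum>k\<le>?d. of_int (poly.coeff p k) * \<beta> i ^ k)"
    by (subst sum.reindex) (auto intro: inj_on_subset[OF inj] sum.cong simp: lookup_mono eval_mono)
  also have "\<dots> = poly (map_poly of_int p) (\<beta> i)"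
    by (simp add: poly_altdef coeff_map_poly degree_map_poly)
  finally have "mpoly_eval \<beta> P = 0"
    using p(2) by simp
  moreover have "\<forall>m\<in>Poly_Mapping.keys P. Poly_Mapping.keys m \<subseteq> {..<n}"
    using keys_P i by (auto simp: mono_def split: if_splits)
  ultimately have "P = 0"
    using indep unfolding Q_algebraically_independent_def by blast
  then show False
    using lookup_mono[of ?d] p(1) by simp
qed

section \<open>Contradictions from too few generators\<close>

lemma SSC_few_generators:
  fixes xs :: "complex list"
  defines "S \<equiv> set xs \<union> exp ` set xs"
  assumes SSC: "Schanuel_Subset_Conjecture"
    and indep: "Q_linearly_independent (length xs) ((!) xs)"
    and T: "T \<subseteq> S" "card T < length xs"
    and gen: "S \<subseteq> Qbar_adjoin T"
    and a: "a \<in> S" "algebraic a"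
  shows False
proof -
  let ?n = "length xs"
  have img: "(!) xs ` {..<?n} = set xs"
    by (auto simp: set_conv_nth)
  have "finite S"
    by (simp add: S_def)
  then have "finite T"
    using T(1) finite_subset by blast
  \<comment> \<open>Independence makes the entries of \<open>xs\<close> distinct, so
    \<open>S\<close> is large enough to contain a suitable \<open>B\<close>;
    \<open>card T < length xs\<close> leaves room in \<open>B\<close> for \<open>a\<close>.\<close>
  have "inj_on ((!) xs) {..<?n}"
    using indep by (simp add: Q_linearly_independent_def)
  then have "card (set xs) = ?n"
    using card_image img by fastforce
  then have "?n \<le> card S"
    using card_mono[OF \<open>finite S\<close>, of "set xs"] by (auto simp: S_def)
  moreover have "card (insert a T) \<le> ?n"
    using T(2) card_insert_le_m1[of ?n T a] by linarith
  ultimately obtain B where B: "insert a T \<subseteq> B" "B \<subseteq> S" "card B = ?n"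
    using exists_subset_between[of "insert a T" ?n S] T(1) a(1) \<open>finite S\<close> by auto
  then obtain \<beta> where \<beta>: "bij_betw \<beta> {..<?n} B"
    using ex_bij_betw_nat_finite[of B] \<open>finite S\<close>
    by (auto simp: atLeast0LessThan dest: finite_subset)
  then have \<beta>_img: "\<beta> ` {..<?n} = B" and \<beta>_inj: "inj_on \<beta> {..<?n}"
    by (simp_all add: bij_betw_def)
  have S: "(!) xs ` {..<?n} \<union> (\<lambda>i. exp (xs ! i)) ` {..<?n} = S"
    unfolding S_def img[symmetric] by (simp add: image_image)
  have "T \<subseteq> Qbar_adjoin B"
    using B(1) by (auto intro: Qbar_adjoin_incl)
  then have "Qbar_dependent_on S B"
    unfolding Qbar_dependent_on_def
    using gen Qbar_adjoin_minimal by (meson subset_trans)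
  then have "Q_algebraically_independent ?n \<beta>"
    using SSC[unfolded Schanuel_Subset_Conjecture_def, rule_format, of ?n "(!) xs" \<beta>]
      indep \<beta>_inj B(2) T(2) unfolding S \<beta>_img by simp
  moreover obtain i where "i < ?n" "\<beta> i = a"
    using B(1) \<beta>_img by auto
  ultimately show False
    using algebraic_not_Q_algebraically_independent a(2) by blast
qed

text \<open>Treats both constants at once. The unordered equation \<open>{c, exp c} = {a, u}\<close>
  leaves open which of \<open>c\<close> and \<open>exp c\<close> is algebraic, and the factor
  \<open>s\<close> allows \<open>u\<close> to differ from \<open>t\<close> without changing the
  field generated over the algebraic numbers.\<close>

lemma SSC_transcendental_exp_poly_Ln:
  assumes SSC: "Schanuel_Subset_Conjecture"
    and c: "c \<noteq> 0" "{c, exp c} = {a, u}" and a: "algebraic a"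
    and u: "u = s * t" "algebraic s" "s \<noteq> 0"
    and P: "\<And>i. algebraic (poly.coeff P i)" "Polynomial.degree P > 0"
    and Q: "\<And>i. algebraic (poly.coeff Q i)" "Polynomial.degree Q > 0"
  shows "\<not> algebraic (exp (poly Q t * Ln (poly P t)))"
proof
  define q L where "q = poly Q t" and "L = Ln (poly P t)"
  assume "algebraic (exp (poly Q t * Ln (poly P t)))"
  then have A: "algebraic (exp (q * L))"
    by (simp add: q_def L_def)
  have c_exp: "{c, exp c} \<subseteq> Qbar_adjoin V" if "u \<in> Qbar_adjoin V" for V
    using that c(2) a by (auto intro: Qbar_adjoin_algebraic)
  \<comment> \<open>This is the conjecture for the single number \<open>c\<close>: were
    \<open>u\<close> algebraic, the empty set would generate both \<open>c\<close> and
    \<open>exp c\<close>.\<close>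
  have u_trans: "\<not> algebraic u"
  proof
    assume "algebraic u"
    have "Q_linearly_independent (length [c]) ((!) [c])"
      by (rule Q_linearly_independentI) (use c(1) in simp)
    moreover have "{c, exp c} \<subseteq> Qbar_adjoin {}"
      by (rule c_exp) (rule Qbar_adjoin_algebraic[OF \<open>algebraic u\<close>])
    moreover have "u \<in> {c, exp c}"
      using c(2) by blast
    ultimately show False
      using SSC_few_generators[OF SSC, of "[c]" "{}" u] \<open>algebraic u\<close> by auto
  qed
  then have t_trans: "\<not> algebraic t"
    using u algebraic_mult by blast
  have "\<not> algebraic (poly P t)" and q_trans: "\<not> algebraic q"
    unfolding q_def using transcendental_poly[OF t_trans] P Q by blast+
  \<comment> \<open>The value 0 is excluded so that \<open>exp\<close> inverts \<open>Ln\<close>,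
    the value 1 so that \<open>L\<close> is nonzero.\<close>
  then have "poly P t \<noteq> 0" and "poly P t \<noteq> 1"
    by auto
  then have exp_L: "exp L = poly P t"
    by (simp add: L_def)
  with \<open>poly P t \<noteq> 1\<close> have L_nz: "L \<noteq> 0"
    by auto
  \<comment> \<open>As \<open>q\<close> is transcendental, 1 and \<open>q\<close> are linearly
    independent over the rationals.\<close>
  have q_lin: "y = 0 \<and> z = 0" if "of_rat y + of_rat z * q = 0" for y z
  proof -
    have "z = 0"
    proof (rule ccontr)
      assume "z \<noteq> 0"
      then have "q = of_rat (- y / z)"
        using that by (simp add: of_rat_divide of_rat_minus field_simps eq_neg_iff_add_eq_0)
      then show False
        using q_trans by simp
    qed
    with that show ?thesis
      by simp
  qed
  have t_adj: "t \<in> Qbar_adjoin V" if "u \<in> Qbar_adjoin V" for V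
  proof -
    have "t = inverse s * u"
      using u by simp
    then show ?thesis
      using that u(2) by (metis Qbar_adjoin_mult Qbar_adjoin_algebraic algebraic_inverse)
  qed
  have P_adj: "poly P t \<in> Qbar_adjoin V" and q_adj: "q \<in> Qbar_adjoin V"
    if "u \<in> Qbar_adjoin V" for V
    unfolding q_def using t_adj[OF that] P(1) Q(1) by (auto intro: Qbar_adjoin_poly)
  have u_mem: "u \<in> {c, exp c}" and a_mem: "a \<in> {c, exp c}"
    using c(2) by auto
  have u_adj: "u \<in> Qbar_adjoin {u}"
    by (simp add: Qbar_adjoin_incl)

  show False
  proof (cases "Q_linearly_independent 3 ((!) [c, L, q * L])")
    case True
    have adj: "u \<in> Qbar_adjoin {u, L}" "L \<in> Qbar_adjoin {u, L}"
      by (simp_all add: Qbar_adjoin_incl)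
    show False
    proof (rule SSC_few_generators[OF SSC, of "[c, L, q * L]" "{u, L}" a])
      show "card {u, L} < length [c, L, q * L]"
        by (simp add: card_insert_if)
      show "set [c, L, q * L] \<union> exp ` set [c, L, q * L] \<subseteq> Qbar_adjoin {u, L}"
        using adj c_exp[OF adj(1)] P_adj[OF adj(1)] q_adj[OF adj(1)] exp_L A
        by (auto intro: Qbar_adjoin_mult Qbar_adjoin_algebraic)
    qed (use True u_mem a_mem a in \<open>auto simp: numeral_3_eq_3\<close>)
  next
    case False
    then obtain k i where k: "(\<Sum>i<3. of_rat (k i) * [c, L, q * L] ! i) = 0" "i < 3" "k i \<noteq> 0"
      using Q_linearly_independentI by blast
    define x y z where "x = k 0" and "y = k 1" and "z = k 2"
    have rel: "of_rat x * c + (of_rat y + of_rat z * q) * L = 0" and nz: "x \<noteq> 0 \<or> y \<noteq> 0 \<or> z \<noteq> 0"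
      using k by (auto simp: x_def y_def z_def eval_nat_numeral algebra_simps less_Suc_eq)
    \<comment> \<open>Otherwise \<open>y = z = 0\<close> by \<open>q_lin\<close>, and then
      \<open>x = 0\<close> because \<open>c \<noteq> 0\<close>. Hence the relation can be solved for
      \<open>L\<close>.\<close>
    have "of_rat y + of_rat z * q \<noteq> 0"
      using rel nz c(1) q_lin by auto
    then have "L = - of_rat x * c * inverse (of_rat y + of_rat z * q)"
      using rel by (simp add: field_simps eq_neg_iff_add_eq_0)
    moreover have "- of_rat x * c * inverse (of_rat y + of_rat z * q) \<in> Qbar_adjoin {u}"
      using c_exp[OF u_adj] q_adj[OF u_adj]
      by (intro Qbar_adjoin_mult Qbar_adjoin_inverse Qbar_adjoin_add)
        (auto intro: Qbar_adjoin_algebraic)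
    ultimately have L_adj: "L \<in> Qbar_adjoin {u}"
      by simp
    show False
    \<comment> \<open>With \<open>L\<close> generated by \<open>u\<close>, one generator suffices,
      so two independent numbers are enough for a contradiction.\<close>
    proof (cases "Q_linearly_independent 2 ((!) [c, L])")
      case True
      show False
      proof (rule SSC_few_generators[OF SSC, of "[c, L]" "{u}" a])
        show "set [c, L] \<union> exp ` set [c, L] \<subseteq> Qbar_adjoin {u}"
          using L_adj c_exp[OF u_adj] P_adj[OF u_adj] exp_L by auto
      qed (use True u_mem a_mem a in \<open>auto simp: numeral_2_eq_2\<close>)
    next
      case False
      then obtain k i where k: "(\<Sum>i<2. of_rat (k i) * [c, L] ! i) = 0" "i < 2" "k i \<noteq> 0"
        using Q_linearly_independentI by blast
      then have rel: "of_rat (k 0) * c + of_rat (k 1) * L = 0" and nz: "k 0 \<noteq> 0 \<or> k 1 \<noteq> 0"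
        by (auto simp: eval_nat_numeral less_Suc_eq)
      then have "k 1 \<noteq> 0" "k 0 \<noteq> 0"
        using c(1) L_nz by auto
      define r where "r = - k 0 / k 1"
      have L_eq: "L = of_rat r * c"
        using rel \<open>k 1 \<noteq> 0\<close>
        by (simp add: r_def of_rat_divide of_rat_minus field_simps eq_neg_iff_add_eq_0)
      have r_nz: "r \<noteq> 0"
        using \<open>k 1 \<noteq> 0\<close> \<open>k 0 \<noteq> 0\<close> by (simp add: r_def)
      \<comment> \<open>Since \<open>q * L = of_rat r * q * c\<close>, a relation between
        \<open>c\<close> and \<open>q * L\<close> becomes, after cancelling \<open>c\<close>, one
        between 1 and \<open>q\<close>.\<close>
      have indep: "Q_linearly_independent 2 ((!) [c, q * L])"
      proof (rule Q_linearly_independentI)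
        fix m :: "nat \<Rightarrow> rat" and i :: nat
        assume "(\<Sum>i<2. of_rat (m i) * [c, q * L] ! i) = 0" "i < 2"
        then have "(of_rat (m 0) + of_rat (m 1 * r) * q) * c = 0"
          by (simp add: eval_nat_numeral L_eq of_rat_mult algebra_simps)
        then have "m 0 = 0 \<and> m 1 * r = 0"
          using c(1) q_lin by (metis mult_eq_0_iff)
        then show "m i = 0"
          using \<open>i < 2\<close> r_nz by (auto simp: less_2_cases_iff)
      qed
      show False
      proof (rule SSC_few_generators[OF SSC, of "[c, q * L]" "{u}" a])
        show "set [c, q * L] \<union> exp ` set [c, q * L] \<subseteq> Qbar_adjoin {u}"
          using L_adj c_exp[OF u_adj] q_adj[OF u_adj] A
          by (auto intro: Qbar_adjoin_mult Qbar_adjoin_algebraic)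
      qed (use indep u_mem a_mem a in \<open>auto simp: numeral_2_eq_2\<close>)
    qed
  qed
qed

theorem theorem2:
  fixes P Q :: "complex poly"
  assumes "Schanuel_Subset_Conjecture"
    and "\<forall>i. algebraic (poly.coeff P i)" and "\<forall>i. algebraic (poly.coeff Q i)"
    and "Polynomial.degree P > 0" and "Polynomial.degree Q > 0"
  shows "\<not> algebraic (exp (poly Q (exp 1) * Ln (poly P (exp 1)))) \<and>
         \<not> algebraic (exp (poly Q (of_real pi) * Ln (poly P (of_real pi))))"
proof
  \<comment> \<open>Here \<open>c = a = 1\<close>, \<open>u = exp 1\<close> and
    \<open>s = 1\<close>.\<close>
  show "\<not> algebraic (exp (poly Q (exp 1) * Ln (poly P (exp 1))))"
    by (rule SSC_transcendental_exp_poly_Ln[OF assms(1), of 1 1 "exp 1" 1])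
      (use assms in auto)
  \<comment> \<open>Here \<open>c = u = \<i> * of_real pi\<close>, \<open>s = \<i>\<close>, and
    \<open>a = - 1\<close> is the value of \<open>exp c\<close> by Euler's identity.\<close>
  show "\<not> algebraic (exp (poly Q (of_real pi) * Ln (poly P (of_real pi))))"
    by (rule SSC_transcendental_exp_poly_Ln[OF assms(1), of "\<i> * of_real pi" "- 1" "\<i> * of_real pi" \<i>])
      (use assms in auto)
qed

end
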